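(* Let $q$ be a power of a prime $p$, and let $e\ge1$ and $n\ge2$. Let $g\in\mathbf{F}_q[T]$ satisfy $g(0)=0$, and suppose that $\Psi_{g,e,n}$ is a mock automorphism over $\mathbf{F}_q$. Then exactly one of the following occurs: (1) $g=0$, in which case $\Psi_{g,e,n}=\operatorname{id}$ and $\mathcal{S}_q(\Psi_{g,e,n})=\mathbf{N}_{>0}$; (2) $g\neq 0$, in which case the spectrum $\mathcal{S}_q(\Psi_{g,e,n})$ is finite and $$m\in\mathcal{S}_q(\Psi_{g,e,n})\quad\Longrightarrow\quad q^m\leq\deg g.$$ Conversely, $\mathbf{N}_{>0}$ and every finite nonempty divisor-closed subset of $\mathbf{N}_{>0}$ occur as spectra $\mathcal{S}_q(\Psi_{g,e,n})$ of mock automorphisms $\Psi_{g,e,n}$ over $\mathbf{F}_q$ in this family (with $g\in\mathbf{F}_q[T]$, $g(0)=0$).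
   Context: For $g\in\mathbf{F}_q[T]$ with $g(0)=0$, define the polynomial map $\Psi_{g,e,n}(X_1,\ldots,X_n)=\bigl(X_1+(X_2\,g(X_1))^{p^e},X_2,\ldots,X_n\bigr)$. A polynomial map $F\in\mathbf{F}_q[X_1,\ldots,X_n]^n$ is a Keller map if the determinant of its Jacobian matrix is a nonzero constant; it is a mock automorphism over $\mathbf{F}_q$ if it is a Keller map and the induced function $\mathbf{F}_q^n\to\mathbf{F}_q^n$ is bijective. Its finite-extension permutation spectrum is $\mathcal{S}_q(F)=\{m\in\mathbf{N}_{>0}: F\colon\mathbf{F}_{q^m}^n\to\mathbf{F}_{q^m}^n\text{ is bijective}\}$. A set $D\subseteq\mathbf{N}_{>0}$ is divisor-closed if $m\in D$ and $d\mid m$ imply $d\in D$. *)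

theory Defs
  imports
    "HOL-Library.Poly_Mapping"
    "HOL-Library.Cardinality"
    "HOL-Computational_Algebra.Polynomial"
    "HOL-Computational_Algebra.Primes"
    "HOL-Number_Theory.Residues"
    "HOL-Algebra.Algebraic_Closure_Type"
    "Jordan_Normal_Form.Determinant"
begin

unbundle no fps_syntax
hide_const (open) Divisibility.prime

section \<open>Multivariate polynomials\<close>

text \<open>
  A monomial is a finitely supported exponent function, a polynomial a finitely supported
  function from monomials to coefficients, with the convolution product. The variables are
  indexed from 0, so that the \<open>X_i\<close> of the usual notation is \<open>mp_var (i - 1)\<close>.
\<close>

type_synonym 'a mpoly = "(nat \<Rightarrow>\<^sub>0 nat) \<Rightarrow>\<^sub>0 'a"

definition mp_const :: "'a::zero \<Rightarrow> 'a mpoly" where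
  "mp_const c = Poly_Mapping.single 0 c"

definition mp_var :: "nat \<Rightarrow> 'a::zero_neq_one mpoly" where
  "mp_var i = Poly_Mapping.single (Poly_Mapping.single i 1) 1"

definition mp_vars :: "'a::zero mpoly \<Rightarrow> nat set" where
  "mp_vars P = (\<Union>m \<in> Poly_Mapping.keys P. Poly_Mapping.keys m)"

text \<open>
  The value of \<open>P\<close> at the point \<open>x\<close>, the coefficients being sent to the ring of the point by \<open>h\<close>.
\<close>

definition mp_eval :: "('a::zero \<Rightarrow> 'b::comm_semiring_1) \<Rightarrow> 'a mpoly \<Rightarrow> (nat \<Rightarrow> 'b) \<Rightarrow> 'b" where
  "mp_eval h P x =
     (\<Sum>m \<in> Poly_Mapping.keys P. h (Poly_Mapping.lookup P m) *
        (\<Prod>i \<in> Poly_Mapping.keys m. x i ^ Poly_Mapping.lookup m i))"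

text \<open>
  The truncated subtraction of exponents is harmless: a monomial without \<open>X_i\<close> gets the
  coefficient 0.
\<close>

definition mp_pderiv :: "nat \<Rightarrow> 'a::comm_semiring_1 mpoly \<Rightarrow> 'a mpoly" where
  "mp_pderiv i P =
     (\<Sum>m \<in> Poly_Mapping.keys P.
        Poly_Mapping.single (m - Poly_Mapping.single i 1)
          (of_nat (Poly_Mapping.lookup m i) * Poly_Mapping.lookup P m))"

section \<open>Polynomial maps\<close>

definition poly_maps :: "nat \<Rightarrow> 'a::zero mpoly vec set" where
  "poly_maps n = {F \<in> carrier_vec n. \<forall>i<n. mp_vars (F $ i) \<subseteq> {..<n}}"

definition id_map :: "nat \<Rightarrow> 'a::zero_neq_one mpoly vec" where
  "id_map n = vec n mp_var"

definition induced_fun :: "('a::zero \<Rightarrow> 'b::comm_semiring_1) \<Rightarrow> 'a mpoly vec \<Rightarrow> 'b vec \<Rightarrow> 'b vec" where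
  "induced_fun h F v = vec (dim_vec F) (\<lambda>i. mp_eval h (F $ i) (\<lambda>j. v $ j))"

definition jacobian :: "'a::comm_semiring_1 mpoly vec \<Rightarrow> 'a mpoly mat" where
  "jacobian F = mat (dim_vec F) (dim_vec F) (\<lambda>(i, j). mp_pderiv j (F $ i))"

definition keller_map :: "nat \<Rightarrow> 'a::comm_ring_1 mpoly vec \<Rightarrow> bool" where
  "keller_map n F \<longleftrightarrow> F \<in> poly_maps n \<and> (\<exists>c. c \<noteq> 0 \<and> det (jacobian F) = mp_const c)"

definition mock_automorphism :: "nat \<Rightarrow> 'a::finite_field mpoly vec \<Rightarrow> bool" where
  "mock_automorphism n F \<longleftrightarrow>
     keller_map n F \<and> bij_betw (induced_fun id F) (carrier_vec n) (carrier_vec n)"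

section \<open>Finite extensions and the permutation spectrum\<close>

text \<open>
  For a finite field \<open>'a\<close> with \<open>q\<close> elements, the extension with \<open>q^m\<close> elements is realised inside
  the algebraic closure as the fixed field of the \<open>m\<close>-th power of the \<open>q\<close>-Frobenius. The lemmas
  below confirm that, for \<open>m > 0\<close>, it is a subfield containing \<open>'a\<close>, that it has \<open>q^m\<close> elements,
  and that it is the only subfield of the algebraic closure of that size.
\<close>

definition ext_field :: "nat \<Rightarrow> 'a::finite_field alg_closure set" where
  "ext_field m = {x. x ^ (CARD('a) ^ m) = x}"

lemma CHAR_eq_if_CARD_eq_power:
  assumes "prime p" "CARD('a::finite_field) = p ^ r"
  shows "CHAR('a) = p"
proof -
  have "CHAR('a) dvd p ^ r"
    using CHAR_dvd_CARD[where 'a = 'a] assms(2) by simp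
  then have "CHAR('a) dvd p"
    using CHAR_prime[where 'a = 'a] prime_dvd_power by blast
  then show ?thesis
    using CHAR_prime[where 'a = 'a] assms(1) primes_dvd_imp_eq by blast
qed

lemma range_to_ac_subset_ext_field: "range to_ac \<subseteq> (ext_field m :: 'a::finite_field alg_closure set)"
proof -
  have "(to_ac x :: 'a alg_closure) ^ (CARD('a) ^ m) = to_ac x" for x
    by (simp add: finite_field_power_card_power_eq_same flip: to_ac_power)
  then show ?thesis
    by (auto simp: ext_field_def)
qed

lemma ext_field_closed:
  fixes x y :: "'a::finite_field alg_closure"
  assumes "prime p" "CARD('a) = p ^ r" and xy: "x \<in> ext_field m" "y \<in> ext_field m"
  shows "x + y \<in> ext_field m" "- x \<in> ext_field m" "x * y \<in> ext_field m" "inverse x \<in> ext_field m"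
proof -
  let ?N = "CARD('a) ^ m"
  have char: "CHAR('a alg_closure) = p"
    using CHAR_eq_if_CARD_eq_power[OF assms(1,2)] by simp
  have N: "?N = CHAR('a alg_closure) ^ (r * m)"
    by (simp only: assms(2) char power_mult)
  have add: "(u + v) ^ ?N = u ^ ?N + v ^ ?N" for u v :: "'a alg_closure"
    using freshmans_dream'[OF _ N] char assms(1) by simp
  show plus: "x + y \<in> ext_field m"
    using xy add by (simp add: ext_field_def)
  have "(- x) ^ ?N + x ^ ?N = 0"
    using add[of "- x" x] by (simp add: power_0_left)
  then show "- x \<in> ext_field m"
    using xy by (simp add: ext_field_def eq_neg_iff_add_eq_0)
  show "x * y \<in> ext_field m" "inverse x \<in> ext_field m"
    using xy by (auto simp: ext_field_def power_mult_distrib power_inverse)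
qed

lemma card_ext_field:
  assumes "0 < m"
  shows "card (ext_field m :: 'a::finite_field alg_closure set) = CARD('a) ^ m"
proof -
  define N where "N = CARD('a) ^ m"
  have "CARD('a) \<noteq> 1"
    using zero_neq_one[where 'a = 'a] by (metis UNIV_I card_1_singletonE singletonD)
  then have card_gt_1: "1 < CARD('a)"
    using zero_less_card_finite[where 'a = 'a] by linarith
  then have N: "1 < N"
    using one_less_power[OF card_gt_1 assms] by (simp add: N_def)
  have "CHAR('a) dvd N"
    using CHAR_dvd_CARD[where 'a = 'a] assms unfolding N_def by (meson dvd_power dvd_trans)
  then have N0: "(of_nat N :: 'a alg_closure) = 0"
    by (simp add: of_nat_eq_0_iff_char_dvd)
  define P :: "'a alg_closure poly" where "P = Polynomial.monom 1 N - Polynomial.monom 1 1"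
  have degP: "Polynomial.degree P = N"
  proof (rule antisym)
    show "Polynomial.degree P \<le> N"
      unfolding P_def using N by (intro degree_diff_le) (auto intro: order.trans[OF degree_monom_le])
    show "N \<le> Polynomial.degree P"
      using N by (intro le_degree) (simp add: P_def)
  qed
  then have P0: "P \<noteq> 0"
    using N by auto
  have pd: "pderiv P = - 1"
    by (simp add: P_def pderiv_diff pderiv_monom N0 one_pCons monom_0)
  have order1: "order a P = 1" if a: "poly P a = 0" for a
  proof -
    obtain Q where Q: "P = [:-a, 1:] * Q"
      using a by (meson dvdE poly_eq_0_iff_dvd)
    have "poly (pderiv P) a = poly Q a"
      unfolding Q by (simp only: pderiv_mult) (simp add: pderiv_pCons)
    then have "poly Q a = - 1"
      using pd by simp
    then have "order a Q = 0"
      by (simp add: order_0I)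
    moreover have "order a [:-a, 1:] = 1"
      using order_power_n_n[of a 1] by simp
    ultimately show ?thesis
      using order_mult[of "[:-a, 1:]" Q a] P0 Q by simp
  qed
  obtain A where A: "size A = Polynomial.degree P"
      "P = Polynomial.smult (lead_coeff P) (\<Prod>x\<in>#A. [:-x, 1:])"
    using alg_closed_imp_factorization[OF P0] by blast
  have "proots P = proots (\<Prod>x\<in>#A. [:-x, 1:])"
    using P0 A(2) by (metis leading_coeff_0_iff proots_smult)
  also have "\<dots> = A"
  proof (induction A)
    case (add x A)
    have "(\<Prod>x\<in>#A. [:-x, 1:]) \<noteq> 0"
      by (auto simp: prod_mset_zero_iff)
    then have "proots ([:-x, 1:] * (\<Prod>x\<in>#A. [:-x, 1:])) =
        proots [:-x, 1:] + proots (\<Prod>x\<in>#A. [:-x, 1:])"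
      by (intro proots_mult) auto
    then show ?case
      using add by simp
  qed simp
  finally have pA: "proots P = A" .
  have "size (proots P) = (\<Sum>x\<in>{x. poly P x = 0}. order x P)"
    using P0 by (simp add: size_multiset_overloaded_eq)
  also have "\<dots> = (\<Sum>x\<in>{x. poly P x = 0}. 1)"
    using order1 by (intro sum.cong) auto
  finally have "card {x. poly P x = 0} = N"
    using pA A(1) degP by simp
  moreover have "{x. poly P x = 0} = ext_field m"
    by (auto simp: P_def ext_field_def poly_monom N_def)
  ultimately show ?thesis
    by (simp add: N_def)
qed

lemma ext_field_unique:
  fixes K :: "'a::finite_field alg_closure set"
  assumes "0 < m" "card K = CARD('a) ^ m" "0 \<in> K"
    and mult: "\<And>x y. x \<in> K \<Longrightarrow> y \<in> K \<Longrightarrow> x * y \<in> K"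
  shows "K = ext_field m"
proof -
  let ?N = "CARD('a) ^ m"
  have Npos: "0 < ?N"
    by simp
  have fin: "finite K"
    using assms(2) Npos by (metis card.infinite less_irrefl)
  have "x ^ ?N = x" if "x \<in> K" for x
  proof (cases "x = 0")
    case False
    have sub: "(*) x ` (K - {0}) \<subseteq> K - {0}"
      using that mult False by auto
    have inj: "inj_on ((*) x) (K - {0})"
      using False by (auto simp: inj_on_def)
    have im: "(*) x ` (K - {0}) = K - {0}"
      using endo_inj_surj[OF _ sub inj] fin by blast
    have "(\<Prod>y\<in>K - {0}. y) = (\<Prod>y\<in>K - {0}. x * y)"
      using prod.reindex[OF inj, of id] im by simp
    also have "\<dots> = x ^ card (K - {0}) * (\<Prod>y\<in>K - {0}. y)"
      by (simp add: prod.distrib)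
    finally have "x ^ card (K - {0}) = 1"
      using fin by simp
    moreover have "card (K - {0}) = ?N - 1"
      using assms(2,3) fin by simp
    ultimately show ?thesis
      using Npos by (metis One_nat_def Suc_pred mult.right_neutral power_Suc)
  qed simp
  then have "K \<subseteq> ext_field m"
    by (auto simp: ext_field_def)
  moreover have "finite (ext_field m :: 'a alg_closure set)"
    using card_ext_field[OF assms(1), where 'a = 'a] Npos by (metis card.infinite less_irrefl)
  ultimately show ?thesis
    using card_ext_field[OF assms(1), where 'a = 'a] assms(2) by (metis card_subset_eq)
qed

definition ext_space :: "nat \<Rightarrow> nat \<Rightarrow> 'a::finite_field alg_closure vec set" where
  "ext_space n m = {v \<in> carrier_vec n. \<forall>i<n. v $ i \<in> ext_field m}"

definition spectrum :: "nat \<Rightarrow> 'a::finite_field mpoly vec \<Rightarrow> nat set" where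
  "spectrum n F = {m. 0 < m \<and> bij_betw (induced_fun to_ac F) (ext_space n m) (ext_space n m)}"

definition divisor_closed :: "nat set \<Rightarrow> bool" where
  "divisor_closed D \<longleftrightarrow> D \<subseteq> {0<..} \<and> (\<forall>m\<in>D. \<forall>d. d dvd m \<longrightarrow> d \<in> D)"

section \<open>The family of maps\<close>

text \<open>\<open>g(X_1)\<close>, a univariate polynomial evaluated in the multivariate polynomial ring, is
  \<open>poly (map_poly mp_const g) (mp_var 0)\<close>.\<close>

definition Psi :: "nat \<Rightarrow> 'a::comm_ring_1 poly \<Rightarrow> nat \<Rightarrow> nat \<Rightarrow> 'a mpoly vec" where
  "Psi p g e n = vec n (\<lambda>i.
     if i = 0
     then mp_var 0 + (mp_var 1 * poly (map_poly mp_const g) (mp_var 0)) ^ (p ^ e)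
     else mp_var i)"

end

theory Submission
  imports Defs
begin

text \<open>
  In characteristic \<open>p\<close> every \<open>\<Psi>\<close> has Jacobian matrix 1. On the field with \<open>q^m\<close> elements it is
  bijective exactly if \<open>g\<close> vanishes there: if \<open>g(x) \<noteq> 0\<close>, then surjectivity of the Frobenius yields a
  value \<open>b\<close> of the second variable with \<open>(b g(x))^(p^e) = -x\<close>, and the points with first coordinates
  \<open>x\<close> and \<open>0\<close> collide. Counting roots bounds \<open>q^m\<close> by the degree of \<open>g \<noteq> 0\<close>.

  A finite divisor-closed \<open>D\<close> is the spectrum for \<open>g = \<Prod>m\<in>D. (T^(q^m) - T)\<close>: the extension of degree
  \<open>k\<close> has more elements than all smaller extensions together, hence an element that lies in the
  extension of degree \<open>m\<close> only if \<open>k\<close> divides \<open>m\<close>.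
\<close>

section \<open>Multivariate polynomials\<close>

lemma poly_mapping_sum_single:
  "P = (\<Sum>m\<in>Poly_Mapping.keys P. Poly_Mapping.single m (Poly_Mapping.lookup P m))"
  by (rule poly_mapping_eqI) (simp add: lookup_sum lookup_single when_def in_keys_iff)

text \<open>This lets the freshman's dream be applied in the polynomial ring with the characteristic
  of the coefficients.\<close>

lemma CHAR_poly_mapping [simp]: "CHAR('b::comm_monoid_add \<Rightarrow>\<^sub>0 'a::comm_semiring_1) = CHAR('a)"
proof (rule CHAR_eqI)
  have of_nat_eq: "(of_nat k :: 'b \<Rightarrow>\<^sub>0 'a) = Poly_Mapping.single 0 (of_nat k)" for k
    by simp
  show "(of_nat CHAR('a) :: 'b \<Rightarrow>\<^sub>0 'a) = 0"
    by (simp only: of_nat_eq of_nat_CHAR single_zero)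
  show "CHAR('a) dvd k" if "(of_nat k :: 'b \<Rightarrow>\<^sub>0 'a) = 0" for k
  proof -
    have "(of_nat k :: 'a) = Poly_Mapping.lookup (of_nat k :: 'b \<Rightarrow>\<^sub>0 'a) 0"
      by (simp add: lookup_of_nat)
    then show ?thesis
      using that by (simp add: of_nat_eq_0_iff_char_dvd)
  qed
qed

section \<open>Evaluation as a ring homomorphism\<close>

definition monomial_eval :: "(nat \<Rightarrow>\<^sub>0 nat) \<Rightarrow> (nat \<Rightarrow> 'b::comm_semiring_1) \<Rightarrow> 'b" where
  "monomial_eval m x = (\<Prod>i \<in> Poly_Mapping.keys m. x i ^ Poly_Mapping.lookup m i)"

text \<open>Extra indices have exponent 0 and contribute the factor 1, so two monomials can share
  one index set.\<close>

lemma monomial_eval_superset: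
  assumes "finite S" "Poly_Mapping.keys m \<subseteq> S"
  shows "monomial_eval m x = (\<Prod>i\<in>S. x i ^ Poly_Mapping.lookup m i)"
  unfolding monomial_eval_def using assms
  by (intro prod.mono_neutral_left) (auto simp: in_keys_iff)

lemma monomial_eval_0 [simp]: "monomial_eval 0 x = 1"
  by (simp add: monomial_eval_def)

lemma monomial_eval_add: "monomial_eval (m + k) x = monomial_eval m x * monomial_eval k x"
proof -
  let ?S = "Poly_Mapping.keys m \<union> Poly_Mapping.keys k"
  have "monomial_eval (m + k) x = (\<Prod>i\<in>?S. x i ^ Poly_Mapping.lookup (m + k) i)"
    by (rule monomial_eval_superset) (use keys_add[of m k] in auto)
  also have "\<dots> = (\<Prod>i\<in>?S. x i ^ Poly_Mapping.lookup m i) * (\<Prod>i\<in>?S. x i ^ Poly_Mapping.lookup k i)"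
    by (simp add: lookup_add power_add prod.distrib)
  also have "\<dots> = monomial_eval m x * monomial_eval k x"
    by (simp add: monomial_eval_superset[of ?S m] monomial_eval_superset[of ?S k])
  finally show ?thesis .
qed

context comm_ring_hom
begin

lemma mp_eval_superset:
  assumes "finite S" "Poly_Mapping.keys P \<subseteq> S"
  shows "mp_eval hom P x = (\<Sum>m\<in>S. hom (Poly_Mapping.lookup P m) * monomial_eval m x)"
  unfolding mp_eval_def monomial_eval_def using assms
  by (intro sum.mono_neutral_left) (auto simp: in_keys_iff)

lemma mp_eval_single: "mp_eval hom (Poly_Mapping.single m c) x = hom c * monomial_eval m x"
  using mp_eval_superset[of "{m}" "Poly_Mapping.single m c" x] by simp

lemma mp_eval_0 [simp]: "mp_eval hom 0 x = 0"
  by (simp add: mp_eval_def)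

lemma mp_eval_add: "mp_eval hom (P + Q) x = mp_eval hom P x + mp_eval hom Q x"
proof -
  let ?S = "Poly_Mapping.keys P \<union> Poly_Mapping.keys Q"
  have "mp_eval hom (P + Q) x =
      (\<Sum>m\<in>?S. hom (Poly_Mapping.lookup (P + Q) m) * monomial_eval m x)"
    by (rule mp_eval_superset) (use keys_add[of P Q] in auto)
  then show ?thesis
    by (simp add: lookup_add hom_add distrib_right sum.distrib
        mp_eval_superset[of ?S P] mp_eval_superset[of ?S Q])
qed

lemma mp_eval_sum: "mp_eval hom (sum F A) x = (\<Sum>a\<in>A. mp_eval hom (F a) x)"
  by (induction A rule: infinite_finite_induct) (simp_all add: mp_eval_add)

lemma mp_eval_mult: "mp_eval hom (P * Q) x = mp_eval hom P x * mp_eval hom Q x"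
proof -
  have "P * Q = (\<Sum>m\<in>Poly_Mapping.keys P. \<Sum>k\<in>Poly_Mapping.keys Q.
      Poly_Mapping.single (m + k) (Poly_Mapping.lookup P m * Poly_Mapping.lookup Q k))"
    by (subst poly_mapping_sum_single[of P], subst poly_mapping_sum_single[of Q])
       (simp add: sum_product mult_single)
  then show ?thesis
    by (simp add: mp_eval_sum mp_eval_single monomial_eval_add hom_mult sum_product
        mp_eval_superset[of "Poly_Mapping.keys P" P] mp_eval_superset[of "Poly_Mapping.keys Q" Q]
        mult_ac)
qed

lemma mp_eval_const [simp]: "mp_eval hom (mp_const c) x = hom c"
  by (simp add: mp_const_def mp_eval_single)

lemma mp_eval_var [simp]: "mp_eval hom (mp_var i) x = x i"
  by (simp add: mp_var_def mp_eval_single monomial_eval_def)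

lemma mp_eval_power: "mp_eval hom (P ^ k) x = mp_eval hom P x ^ k"
proof (induction k)
  case 0
  have "mp_eval hom 1 x = 1"
    using mp_eval_single[of 0 1 x] by simp
  then show ?case by simp
qed (simp add: mp_eval_mult)

text \<open>Induction along Horner's scheme; this links the encoding of \<open>g(X_1)\<close> to
  univariate evaluation.\<close>

lemma mp_eval_poly:
  "mp_eval hom (poly (map_poly mp_const g) P) x = poly (map_poly hom g) (mp_eval hom P x)"
  by (induction g)
     (simp_all add: map_poly_pCons mp_const_def[of 0] mp_eval_add mp_eval_mult)

end

section \<open>Variables occurring in a polynomial\<close>

lemma mp_vars_var [simp]: "mp_vars (mp_var i) = {i}"
  by (simp add: mp_vars_def mp_var_def)

lemma mp_vars_const [simp]: "mp_vars (mp_const c) = {}"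
  by (simp add: mp_vars_def mp_const_def)

lemma mp_vars_add: "mp_vars (P + Q) \<subseteq> mp_vars P \<union> mp_vars Q"
  using keys_add[of P Q] by (auto simp: mp_vars_def)

lemma mp_vars_mult: "mp_vars (P * Q) \<subseteq> mp_vars P \<union> mp_vars Q"
proof
  fix i assume "i \<in> mp_vars (P * Q)"
  then obtain a b where "a \<in> Poly_Mapping.keys P" "b \<in> Poly_Mapping.keys Q"
      "i \<in> Poly_Mapping.keys (a + b)"
    using keys_mult[of P Q] unfolding mp_vars_def by blast
  then show "i \<in> mp_vars P \<union> mp_vars Q"
    using keys_add[of a b] by (auto simp: mp_vars_def)
qed

lemma mp_vars_power: "mp_vars (P ^ k) \<subseteq> mp_vars P"
proof (induction k)
  case 0
  then show ?case by (simp add: mp_vars_def)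
next
  case (Suc k)
  then show ?case using mp_vars_mult[of P "P ^ k"] by auto
qed

lemma mp_vars_poly: "mp_vars (poly (map_poly mp_const g) P) \<subseteq> mp_vars P"
proof (induction g)
  case 0
  then show ?case by (simp add: mp_vars_def)
next
  case (pCons c g)
  let ?R = "poly (map_poly mp_const g) P"
  have "mp_vars (mp_const c + P * ?R) \<subseteq> mp_vars P"
    using mp_vars_add[of "mp_const c" "P * ?R"] mp_vars_mult[of P ?R] pCons by auto
  then show ?case
    by (simp add: map_poly_pCons mp_const_def[of 0])
qed

section \<open>Partial derivatives\<close>

lemma mp_pderiv_superset:
  assumes "finite S" "Poly_Mapping.keys P \<subseteq> S"
  shows "mp_pderiv i P =
     (\<Sum>m\<in>S. Poly_Mapping.single (m - Poly_Mapping.single i 1)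
        (of_nat (Poly_Mapping.lookup m i) * Poly_Mapping.lookup P m))"
  unfolding mp_pderiv_def using assms
  by (intro sum.mono_neutral_left) (auto simp: in_keys_iff)

lemma mp_pderiv_add: "mp_pderiv i (P + Q) = mp_pderiv i P + mp_pderiv i Q"
proof -
  let ?S = "Poly_Mapping.keys P \<union> Poly_Mapping.keys Q"
  have "mp_pderiv i (P + Q) =
     (\<Sum>m\<in>?S. Poly_Mapping.single (m - Poly_Mapping.single i 1)
        (of_nat (Poly_Mapping.lookup m i) * Poly_Mapping.lookup (P + Q) m))"
    by (rule mp_pderiv_superset) (use keys_add[of P Q] in auto)
  then show ?thesis
    by (simp add: lookup_add distrib_left single_add sum.distrib
        mp_pderiv_superset[of ?S P] mp_pderiv_superset[of ?S Q])
qed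

lemma mp_pderiv_var: "mp_pderiv i (mp_var j) = (if i = j then 1 else 0)"
  by (simp add: mp_pderiv_def mp_var_def lookup_single)

text \<open>The exponent is a \<open>k\<close>-fold sum of \<open>m\<close>;
  \<open>sum_constant\<close> would turn it into a convolution product of exponent
  functions.\<close>

lemma single_power:
  "Poly_Mapping.single (m :: nat \<Rightarrow>\<^sub>0 nat) (c :: 'a::comm_semiring_1) ^ k =
   Poly_Mapping.single (\<Sum>j<k. m) (c ^ k)"
  by (induction k) (simp_all add: mult_single add.commute del: sum_constant)

text \<open>By the freshman's dream every monomial of the power has all its exponents divisible by
  \<open>CHAR('a) ^ e\<close>. As \<open>1 \<le> e\<close>, the factors that differentiation
  produces are 0 in \<open>'a\<close>.\<close>

lemma mp_pderiv_CHAR_power: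
  fixes P :: "'a::comm_semiring_1 mpoly"
  assumes "prime CHAR('a)" "1 \<le> e"
  shows "mp_pderiv i (P ^ (CHAR('a) ^ e)) = 0"
proof -
  let ?N = "CHAR('a) ^ e"
  have "P ^ ?N = (\<Sum>m\<in>Poly_Mapping.keys P.
      Poly_Mapping.single m (Poly_Mapping.lookup P m)) ^ ?N"
    by (simp flip: poly_mapping_sum_single)
  also have "\<dots> = (\<Sum>m\<in>Poly_Mapping.keys P.
      Poly_Mapping.single m (Poly_Mapping.lookup P m) ^ ?N)"
    using assms(1) by (intro freshmans_dream_sum'[where n = e]) simp_all
  finally have PN: "P ^ ?N = (\<Sum>m\<in>Poly_Mapping.keys P.
      Poly_Mapping.single (\<Sum>j<?N. m) (Poly_Mapping.lookup P m ^ ?N))"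
    by (simp only: single_power)
  have "of_nat (Poly_Mapping.lookup m i) = (0 :: 'a)" if "m \<in> Poly_Mapping.keys (P ^ ?N)" for m
  proof -
    have "Poly_Mapping.lookup (P ^ ?N) m \<noteq> 0"
      using that by (simp add: in_keys_iff)
    then obtain k where "m = (\<Sum>j<?N. k)"
      unfolding PN lookup_sum lookup_single when_def
      by (elim sum.not_neutral_contains_not_neutral) (metis (full_types))
    then have "Poly_Mapping.lookup m i = ?N * Poly_Mapping.lookup k i"
      by (simp add: lookup_sum del: sum_constant) simp
    then show ?thesis
      using assms(2) by (simp add: power_0_left)
  qed
  then show ?thesis
    by (simp add: mp_pderiv_def)
qed

section \<open>Polynomials under ring homomorphisms\<close>

context comm_ring_hom
begin

lemma poly_map_poly_hom: "poly (map_poly hom g) (hom x) = hom (poly g x)"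
  by (induction g) (simp_all add: map_poly_pCons hom_add hom_mult)

lemma map_poly_hom_mult: "map_poly hom (f * g) = map_poly hom f * map_poly hom g"
  by (rule poly_eqI) (simp add: coeff_map_poly coeff_mult hom_sum hom_mult)

lemma map_poly_hom_prod: "map_poly hom (prod f A) = (\<Prod>a\<in>A. map_poly hom (f a))"
  by (induction A rule: infinite_finite_induct) (simp_all add: map_poly_hom_mult)

lemma map_poly_hom_diff: "map_poly hom (f - g) = map_poly hom f - map_poly hom g"
  by (rule poly_eqI) (simp add: coeff_map_poly hom_minus)

end

section \<open>The maps \<open>Psi p g e n\<close>\<close>

lemma dim_vec_Psi [simp]: "dim_vec (Psi p g e n) = n"
  by (simp add: Psi_def)

text \<open>Only the first component differs from a variable, and it does so by a
  \<open>p^e\<close>-th power, whose partial derivatives vanish.\<close>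

lemma keller_map_Psi:
  fixes g :: "'a::comm_ring_1 poly"
  assumes "prime p" "CHAR('a) = p" "1 \<le> e" "2 \<le> n"
  shows "keller_map n (Psi p g e n)"
proof -
  let ?G = "poly (map_poly mp_const g) (mp_var 0) :: 'a mpoly"
  have "mp_vars (mp_var 0 + (mp_var 1 * ?G) ^ (p ^ e)) \<subseteq> {0, 1}"
    using mp_vars_add[of "mp_var 0" "(mp_var 1 * ?G) ^ (p ^ e)"]
      mp_vars_power[of "mp_var 1 * ?G" "p ^ e"] mp_vars_mult[of "mp_var 1" ?G]
      mp_vars_poly[of g "mp_var 0"] by auto
  then have "Psi p g e n \<in> poly_maps n"
    using assms(4) by (auto simp: poly_maps_def Psi_def)
  moreover have "jacobian (Psi p g e n) = 1\<^sub>m n"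
    using mp_pderiv_CHAR_power[of e _ "mp_var 1 * ?G"] assms
    by (intro eq_matI) (auto simp: jacobian_def Psi_def mp_pderiv_add mp_pderiv_var)
  then have "det (jacobian (Psi p g e n)) = mp_const 1"
    by (simp add: mp_const_def)
  ultimately show ?thesis
    unfolding keller_map_def by (metis one_neq_zero)
qed

lemma (in comm_ring_hom) induced_fun_Psi:
  assumes "2 \<le> n" "v \<in> carrier_vec n"
  shows "induced_fun hom (Psi p g e n) v =
    vec n (\<lambda>i. if i = 0 then v $ 0 + (v $ 1 * poly (map_poly hom g) (v $ 0)) ^ (p ^ e) else v $ i)"
  using assms
  by (intro eq_vecI)
     (auto simp: induced_fun_def Psi_def mp_eval_add mp_eval_mult mp_eval_power mp_eval_poly)

text \<open>By \<open>0 < p\<close> the exponent \<open>p ^ e\<close> is positive, so the added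
  power of 0 is 0.\<close>

lemma (in comm_ring_hom) induced_fun_Psi_eq_self:
  fixes v :: "'b vec"
  assumes "0 < p" "2 \<le> n" "v \<in> carrier_vec n" "poly (map_poly hom g) (v $ 0) = 0"
  shows "induced_fun hom (Psi p g e n) v = v"
  using assms by (intro eq_vecI) (auto simp: induced_fun_Psi power_0_left)

lemma Psi_0: "0 < p \<Longrightarrow> Psi p 0 e n = id_map n"
  by (intro eq_vecI) (auto simp: Psi_def id_map_def power_0_left)

section \<open>Finite extensions inside the algebraic closure\<close>

interpretation to_ac: inj_comm_ring_hom "to_ac :: 'a::field \<Rightarrow> 'a alg_closure"
  by unfold_locales auto

lemma degree_map_poly_to_ac [simp]: "Polynomial.degree (map_poly to_ac g) = Polynomial.degree g"
  by (simp add: degree_map_poly)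

lemma ext_field_0 [simp]: "0 \<in> (ext_field m :: 'a::finite_field alg_closure set)"
  by (simp add: ext_field_def)

lemma poly_in_ext_field:
  fixes g :: "'a::finite_field poly"
  assumes "prime p" "CARD('a) = p ^ r" "x \<in> ext_field m"
  shows "poly (map_poly to_ac g) x \<in> ext_field m"
proof (induction g)
  case (pCons c g)
  have "to_ac c \<in> (ext_field m :: 'a alg_closure set)"
    using range_to_ac_subset_ext_field by blast
  then show ?case
    using pCons assms by (simp add: map_poly_pCons ext_field_closed)
qed simp

text \<open>With \<open>N = q^m\<close> one has \<open>x^(N^e) = x\<close>, and
  \<open>N^e = p^(r*m*e)\<close> is a multiple of \<open>p^e\<close> because \<open>r*m\<close> is
  positive. Splitting off the factor \<open>p^e\<close> leaves an explicit root, which is a power of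
  \<open>x\<close>.\<close>

lemma ext_field_Frobenius_surj:
  fixes x :: "'a::finite_field alg_closure"
  assumes "CARD('a) = p ^ r" "1 \<le> r" "0 < m" "x \<in> ext_field m"
  obtains y where "y \<in> ext_field m" "y ^ (p ^ e) = x"
proof
  let ?N = "CARD('a) ^ m"
  have x: "x ^ ?N = x"
    using assms(4) by (simp add: ext_field_def)
  have iter: "x ^ (?N ^ k) = x" for k
    by (induction k) (simp_all add: x power_mult)
  let ?y = "x ^ (p ^ (r * m * e - e))"
  have "?y ^ ?N = (x ^ ?N) ^ (p ^ (r * m * e - e))"
    by (metis power_mult mult.commute)
  then show "?y \<in> ext_field m"
    by (simp only: x ext_field_def mem_Collect_eq)
  have le: "e \<le> r * m * e"
    using assms(2,3) by simp
  have "?N ^ e = p ^ (r * m * e)"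
    by (simp only: assms(1) power_mult)
  also have "\<dots> = p ^ (r * m * e - e) * p ^ e"
    using le by (simp only: power_add[symmetric] le_add_diff_inverse2)
  finally have "x ^ (?N ^ e) = ?y ^ (p ^ e)"
    by (simp only: power_mult)
  then show "?y ^ (p ^ e) = x"
    by (simp only: iter)
qed

text \<open>Where \<open>g\<close> vanishes the map is the identity; a single non-root already
  destroys injectivity.\<close>

lemma mem_spectrum_Psi_iff:
  fixes g :: "'a::finite_field poly"
  assumes p: "prime p" and card: "CARD('a) = p ^ r" and r: "1 \<le> r" and n: "2 \<le> n"
    and g0: "poly g 0 = 0"
  shows "m \<in> spectrum n (Psi p g e n) \<longleftrightarrow>
    0 < m \<and> (\<forall>x\<in>ext_field m. poly (map_poly to_ac g) x = 0)"
proof -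
  let ?f = "induced_fun to_ac (Psi p g e n)"
  let ?E = "ext_space n m :: 'a alg_closure vec set"
  let ?G = "\<lambda>x. poly (map_poly to_ac g) x"
  have p0: "0 < p"
    using p by (simp add: prime_gt_0_nat)
  have "bij_betw ?f ?E ?E" if "\<forall>x\<in>ext_field m. ?G x = 0"
  proof -
    have "?f v = id v" if "v \<in> ?E" for v
      using that n p0 \<open>\<forall>x\<in>ext_field m. ?G x = 0\<close>
      by (simp add: to_ac.induced_fun_Psi_eq_self ext_space_def)
    then show ?thesis
      using bij_betw_cong[of ?E ?f id ?E] by (simp add: bij_betw_def)
  qed
  moreover have "?G x = 0" if m: "0 < m" and bij: "bij_betw ?f ?E ?E" and x: "x \<in> ext_field m" for x
  proof (rule ccontr)
    assume Gx: "?G x \<noteq> 0"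
    have G0: "?G 0 = 0"
      using g0 to_ac.poly_map_poly_hom[of g 0] by simp
    obtain y where y: "y \<in> ext_field m" "y ^ (p ^ e) = x"
      using ext_field_Frobenius_surj[OF card r m x] .
    \<comment> \<open>A root of -1 supplies the sign without distinguishing \<open>p = 2\<close>
      from odd \<open>p\<close>.\<close>
    obtain s :: "'a alg_closure" where s: "s \<in> ext_field m" "s ^ (p ^ e) = - 1"
    proof (rule ext_field_Frobenius_surj[OF card r m])
      have "(1 :: 'a alg_closure) \<in> ext_field m"
        by (simp add: ext_field_def)
      then show "(- 1 :: 'a alg_closure) \<in> ext_field m"
        using ext_field_closed[OF p card] by blast
    qed
    define b where "b = s * y * inverse (?G x)"
    have b: "b \<in> ext_field m"
      unfolding b_def using s y poly_in_ext_field[OF p card x]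
      by (intro ext_field_closed[OF p card])
    \<comment> \<open>Both \<open>u x\<close> and \<open>u 0\<close> are sent to a point with first
      coordinate 0: the added power is \<open>- x\<close> at the former, and 0 at the latter since
      \<open>g(0) = 0\<close>.\<close>
    define u where "u = (\<lambda>z. vec n (\<lambda>i. if i = 0 then z else if i = 1 then b else 0))"
    have u: "u x \<in> ?E" "u 0 \<in> ?E"
      using x b by (auto simp: u_def ext_space_def)
    have "(b * ?G x) ^ (p ^ e) = - x"
      using Gx y s by (simp add: b_def power_mult_distrib power_inverse)
    then have "?f (u x) = ?f (u 0)"
      using n p0 by (intro eq_vecI)
        (auto simp: to_ac.induced_fun_Psi u_def G0 power_0_left)
    then have "u x = u 0"
      using bij u by (auto simp: bij_betw_def inj_on_def)
    then have "u x $ 0 = u 0 $ 0"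
      by simp
    then have "x = 0"
      using n by (simp add: u_def)
    then show False
      using Gx G0 by simp
  qed
  ultimately show ?thesis
    by (auto simp: spectrum_def)
qed

lemma mock_automorphism_Psi:
  fixes g :: "'a::finite_field poly"
  assumes p: "prime p" and card: "CARD('a) = p ^ r" and "1 \<le> e" "2 \<le> n" and g: "\<And>x. poly g x = 0"
  shows "mock_automorphism n (Psi p g e n)"
proof -
  interpret comm_ring_hom "id :: 'a \<Rightarrow> 'a"
    by unfold_locales auto
  have "induced_fun id (Psi p g e n) v = id v" if "v \<in> carrier_vec n" for v
    using that assms by (simp add: induced_fun_Psi_eq_self prime_gt_0_nat)
  then have "bij_betw (induced_fun id (Psi p g e n)) (carrier_vec n) (carrier_vec n)"
    using bij_betw_cong[of "carrier_vec n" "induced_fun id (Psi p g e n)" id "carrier_vec n"]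
    by (simp add: bij_betw_def)
  then show ?thesis
    using keller_map_Psi[OF p CHAR_eq_if_CARD_eq_power[OF p card]] assms
    by (simp add: mock_automorphism_def)
qed

section \<open>Finite spectra\<close>

text \<open>The \<open>q^m\<close> elements of the extension are distinct roots of the nonzero
  polynomial \<open>g\<close>.\<close>

lemma ext_field_card_le_degree:
  fixes g :: "'a::finite_field poly"
  assumes "g \<noteq> 0" "0 < m" "\<forall>x\<in>ext_field m. poly (map_poly to_ac g) x = 0"
  shows "CARD('a) ^ m \<le> Polynomial.degree g"
proof -
  let ?h = "map_poly to_ac g"
  have h: "?h \<noteq> 0"
    using assms(1) by (simp add: map_poly_eq_0_iff)
  have "CARD('a) ^ m = card (ext_field m :: 'a alg_closure set)"
    using card_ext_field[OF assms(2), where 'a = 'a] by simp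
  also have "\<dots> \<le> card {x. poly ?h x = 0}"
    using assms(3) poly_roots_finite[OF h] by (intro card_mono) auto
  also have "\<dots> \<le> Polynomial.degree ?h"
    by (rule card_poly_roots_bound[OF h])
  finally show ?thesis by simp
qed

section \<open>Elements generating an extension\<close>

lemma one_less_CARD_finite_field: "1 < CARD('a::finite_field)"
  using card_mono[of UNIV "{0, 1 :: 'a}"] by simp

text \<open>Iterates of the \<open>d\<close>-th Frobenius power fix \<open>x\<close>, so they can be
  stripped from the \<open>m\<close>-th one. If \<open>d\<close> divides \<open>m\<close>, the
  result is \<open>ext_field 0\<close>, the whole closure.\<close>

lemma ext_field_mod:
  assumes "x \<in> ext_field d" "x \<in> ext_field m"
  shows "x \<in> (ext_field (m mod d) :: 'a::finite_field alg_closure set)"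
proof -
  let ?q = "CARD('a)"
  have iter: "x ^ (?q ^ (d * k)) = x" for k
    using assms(1) by (induction k) (simp_all add: ext_field_def power_add power_mult)
  have "x = x ^ (?q ^ (d * (m div d) + m mod d))"
    using assms(2) by (simp add: ext_field_def)
  also have "\<dots> = (x ^ (?q ^ (d * (m div d)))) ^ (?q ^ (m mod d))"
    by (simp only: power_add power_mult)
  also have "\<dots> = x ^ (?q ^ (m mod d))"
    by (simp only: iter)
  finally show ?thesis
    by (simp add: ext_field_def)
qed

lemma sum_powers_less:
  assumes "1 < (q::nat)"
  shows "(\<Sum>d\<in>{0<..<k}. q ^ d) < q ^ k"
proof (induction k)
  case (Suc k)
  show ?case
  proof (cases "k = 0")
    case False
    then have "{0<..<Suc k} = insert k {0<..<k}"
      by auto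
    then have "(\<Sum>d\<in>{0<..<Suc k}. q ^ d) < 2 * q ^ k"
      using Suc by simp
    also have "\<dots> \<le> q ^ Suc k"
      using assms by simp
    finally show ?thesis .
  next
    case True
    then have "{0<..<Suc k} = {}"
      by auto
    then show ?thesis
      using assms by simp
  qed
qed simp

text \<open>The extensions of smaller positive degree have too few elements to cover
  \<open>ext_field k\<close>; degree 0 must be left out of the union, since
  \<open>ext_field 0\<close> is everything.\<close>

lemma exists_generator_ext_field:
  assumes "0 < k"
  obtains x where "x \<in> (ext_field k :: 'a::finite_field alg_closure set)"
    "\<And>m. x \<in> ext_field m \<Longrightarrow> k dvd m"
proof -
  let ?U = "\<Union>d\<in>{0<..<k}. ext_field d :: 'a alg_closure set"
  have "card ?U \<le> (\<Sum>d\<in>{0<..<k}. card (ext_field d :: 'a alg_closure set))"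
    by (rule card_UN_le) simp
  also have "\<dots> = (\<Sum>d\<in>{0<..<k}. CARD('a) ^ d)"
    by (intro sum.cong) (simp_all add: card_ext_field)
  also have "\<dots> < CARD('a) ^ k"
    by (rule sum_powers_less[OF one_less_CARD_finite_field])
  finally have less: "card ?U < card (ext_field k :: 'a alg_closure set)"
    by (simp add: card_ext_field assms)
  have "finite (ext_field d :: 'a alg_closure set)" if "0 < d" for d
    using card_ext_field[OF that, where 'a = 'a] by (intro card_ge_0_finite) simp
  then have "finite ?U"
    by (intro finite_UN_I) auto
  then have "\<not> ext_field k \<subseteq> ?U"
    using less card_mono[of ?U "ext_field k"] by linarith
  then obtain x :: "'a alg_closure" where x: "x \<in> ext_field k" "x \<notin> ?U"
    by blast
  \<comment> \<open>A nonzero remainder \<open>m mod k\<close> would place \<open>x\<close> in one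
    of the smaller extensions.\<close>
  have "k dvd m" if "x \<in> ext_field m" for m
  proof -
    have "x \<in> ext_field (m mod k)" "m mod k < k"
      using ext_field_mod[OF x(1) that] assms by simp_all
    then have "m mod k = 0"
      using x(2) by auto
    then show ?thesis
      by (simp add: dvd_eq_mod_eq_0)
  qed
  then show thesis
    using that x(1) by blast
qed

text \<open>The roots of the factor \<open>T^(q^m) - T\<close> in the closure are exactly the
  elements of \<open>ext_field m\<close>. For empty \<open>D\<close> the product is 1.\<close>

definition vanishing_poly :: "nat set \<Rightarrow> 'a::finite_field poly" where
  "vanishing_poly D = (\<Prod>m\<in>D. Polynomial.monom 1 (CARD('a) ^ m) - Polynomial.monom 1 1)"

lemma poly_vanishing_poly_eq_0_iff:
  assumes "finite D"
  shows "poly (map_poly to_ac (vanishing_poly D)) x = 0 \<longleftrightarrow> (\<exists>m\<in>D. x \<in> ext_field m)"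
  using assms
  by (simp add: vanishing_poly_def to_ac.map_poly_hom_prod to_ac.map_poly_hom_diff
      map_poly_monom poly_prod poly_monom ext_field_def)

text \<open>A generator of \<open>ext_field k\<close> that is a root lies in
  \<open>ext_field m\<close> for some \<open>m\<close> in \<open>D\<close>. Then \<open>k\<close>
  divides \<open>m\<close>, and divisor-closedness puts \<open>k\<close> into
  \<open>D\<close>.\<close>

lemma vanishing_poly_on_ext_field_iff:
  assumes "finite D" "divisor_closed D" "0 < k"
  shows "(\<forall>x\<in>ext_field k. poly (map_poly to_ac (vanishing_poly D :: 'a::finite_field poly)) x = 0)
    \<longleftrightarrow> k \<in> D"
proof
  assume vanish: "\<forall>x\<in>ext_field k. poly (map_poly to_ac (vanishing_poly D :: 'a poly)) x = 0"
  obtain x :: "'a alg_closure" where x: "x \<in> ext_field k" "\<And>m. x \<in> ext_field m \<Longrightarrow> k dvd m"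
    using exists_generator_ext_field[OF assms(3)] by blast
  then obtain m where "m \<in> D" "x \<in> ext_field m"
    using vanish assms(1) by (auto simp: poly_vanishing_poly_eq_0_iff)
  then show "k \<in> D"
    using x(2) assms(2) by (auto simp: divisor_closed_def)
qed (use assms(1) in \<open>auto simp: poly_vanishing_poly_eq_0_iff\<close>)

text \<open>The base field lies in every extension, so any one factor vanishes on it;
  \<open>D \<noteq> {}\<close> provides this factor.\<close>

lemma poly_vanishing_poly_eq_0:
  assumes "finite D" "D \<noteq> {}"
  shows "poly (vanishing_poly D :: 'a::finite_field poly) x = 0"
proof -
  have "(to_ac x :: 'a alg_closure) \<in> ext_field m" for m
    using range_to_ac_subset_ext_field by blast
  then have "to_ac (poly (vanishing_poly D) x) = 0"
    using assms by (auto simp: poly_vanishing_poly_eq_0_iff simp flip: to_ac.poly_map_poly_hom)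
  then show ?thesis by simp
qed

section \<open>Classification and realisation of the spectra\<close>

theorem corollary4p3:
  fixes p q r e n :: nat
  assumes "prime p" and "1 \<le> r" and "q = p ^ r" and "CARD('a::finite_field) = q"
    and "1 \<le> e" and "2 \<le> n"
  shows
    "(\<forall>g :: 'a poly. poly g 0 = 0 \<and> mock_automorphism n (Psi p g e n) \<longrightarrow>
        (let C1 = (g = 0 \<and> Psi p g e n = id_map n \<and> spectrum n (Psi p g e n) = {0<..});
             C2 = (g \<noteq> 0 \<and> finite (spectrum n (Psi p g e n)) \<and>
                    (\<forall>m. m \<in> spectrum n (Psi p g e n) \<longrightarrow> q ^ m \<le> Polynomial.degree g))
         in (C1 \<or> C2) \<and> \<not> (C1 \<and> C2))) \<and>
     (\<forall>D. D = {0<..} \<or> (finite D \<and> D \<noteq> {} \<and> divisor_closed D) \<longrightarrow>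
        (\<exists>g :: 'a poly. poly g 0 = 0 \<and> mock_automorphism n (Psi p g e n) \<and>
           spectrum n (Psi p g e n) = D))"
proof (intro conjI allI impI)
  fix g :: "'a poly"
  assume "poly g 0 = 0 \<and> mock_automorphism n (Psi p g e n)"
  then have g0: "poly g 0 = 0" by blast
  have card: "CARD('a) = p ^ r"
    using assms by simp
  note mem = mem_spectrum_Psi_iff[OF \<open>prime p\<close> card \<open>1 \<le> r\<close> \<open>2 \<le> n\<close> g0, of _ e]
  have "Psi p g e n = id_map n \<and> spectrum n (Psi p g e n) = {0<..}" if "g = 0"
    using that mem Psi_0[of p e n, where 'a = 'a] \<open>prime p\<close> by (auto simp: prime_gt_0_nat)
  moreover have "finite (spectrum n (Psi p g e n)) \<and>
      (\<forall>m. m \<in> spectrum n (Psi p g e n) \<longrightarrow> q ^ m \<le> Polynomial.degree g)" if "g \<noteq> 0"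
  proof -
    have bound: "q ^ m \<le> Polynomial.degree g" if "m \<in> spectrum n (Psi p g e n)" for m
      using that ext_field_card_le_degree[OF \<open>g \<noteq> 0\<close>] assms mem by auto
    have "1 < q"
      using one_less_CARD_finite_field[where 'a = 'a] assms by simp
    \<comment> \<open>This turns the bound on \<open>q ^ m\<close> into a bound on \<open>m\<close>,
      whence finiteness.\<close>
    then have "m < q ^ m" for m
      by (simp add: power_gt_expt)
    then have "spectrum n (Psi p g e n) \<subseteq> {..Polynomial.degree g}"
      using bound by (auto intro: order.trans[OF less_imp_le])
    then show ?thesis
      using bound finite_subset by blast
  qed
  ultimately show "let C1 = (g = 0 \<and> Psi p g e n = id_map n \<and> spectrum n (Psi p g e n) = {0<..});
             C2 = (g \<noteq> 0 \<and> finite (spectrum n (Psi p g e n)) \<and>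
                    (\<forall>m. m \<in> spectrum n (Psi p g e n) \<longrightarrow> q ^ m \<le> Polynomial.degree g))
         in (C1 \<or> C2) \<and> \<not> (C1 \<and> C2)"
    by (auto simp: Let_def)
next
  fix D :: "nat set"
  assume D: "D = {0<..} \<or> (finite D \<and> D \<noteq> {} \<and> divisor_closed D)"
  have card: "CARD('a) = p ^ r"
    using assms by simp
  \<comment> \<open>An infinite \<open>D\<close> can only be \<open>{0<..}\<close>, which is the
    spectrum of the identity.\<close>
  define g :: "'a poly" where "g = (if finite D then vanishing_poly D else 0)"
  have g: "poly g x = 0" for x
    using D poly_vanishing_poly_eq_0[of D x] by (auto simp: g_def infinite_Ioi)
  \<comment> \<open>For \<open>m = 0\<close> both sides are false, as \<open>D\<close> has only
    positive elements.\<close>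
  have "m \<in> spectrum n (Psi p g e n) \<longleftrightarrow> m \<in> D" for m
    using D vanishing_poly_on_ext_field_iff[of D m, where 'a = 'a]
      mem_spectrum_Psi_iff[OF \<open>prime p\<close> card \<open>1 \<le> r\<close> \<open>2 \<le> n\<close> g, of m e]
    by (auto simp: g_def infinite_Ioi divisor_closed_def)
  then show "\<exists>g :: 'a poly. poly g 0 = 0 \<and> mock_automorphism n (Psi p g e n) \<and>
           spectrum n (Psi p g e n) = D"
    using g mock_automorphism_Psi[OF \<open>prime p\<close> card \<open>1 \<le> e\<close> \<open>2 \<le> n\<close> g] by blast
qed

end
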